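(* Let $1\le \ell\le k\le n-1$ and let $1\le m\le 2\ell-1$ be odd. Put $m'=k+\ell-m$. Then $$(-1)^{k+1}(2m')!\,\mathrm{tr}(E^{m'}F^{m'})\,\omega_{k,\ell}^{(m)}=\mathrm{tr}(E^\ell F^\ell)\,\frac{(2k-m)!\,(2\ell)!}{m!}\,\omega_{m',k}^{(2k-m)}.$$
   Context: Let $n\ge 2$ and let $(E,H,F)$ be a principal $\mathfrak{sl}_2$-triple in $\mathfrak{sl}_n=\mathfrak{sl}_n(\mathbb{C})$ (traceless $n\times n$ matrices): $[H,E]=2E$, $[H,F]=-2F$, $[E,F]=H$, and $E$ is principal nilpotent (a nilpotent matrix with a single Jordan block of size $n$). For $1\le i\le n-1$ and $-i\le j\le i$ put $G_{i,j}=\mathrm{ad}_F^{\,i-j}(E^i)$, where $E^i$ is the matrix power; these form a basis of $\mathfrak{sl}_n$. Put $V_i=\mathrm{Span}(G_{i,j}\mid -i\le j\le i)$, let $\mathcal{H}_{2i}=\mathbb{C}_{2i}[x,y]$ be the space of homogeneous polynomials of degree $2i$, set $m_{i,j}=y^{i-j}\frac{x^{i+j}}{(i+j)!}$, and let $\Phi_i:V_i\to\mathcal{H}_{2i}$ be the linear isomorphism with $\Phi_i(G_{i,j})=m_{i,j}$. For homogeneous $P,Q\in\mathbb{C}[x,y]$ the $m$-th transvectant (Cayley $\Omega$-process, without normalizing factor) is $$(P,Q)_m=\sum_{s=0}^m(-1)^s\binom{m}{s}\frac{\partial^mP}{\partial x^{m-s}\partial y^s}\,\frac{\partial^mQ}{\partial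 x^s\partial y^{m-s}}.$$ For all $1\le k,\ell\le n-1$ the structure constants $\omega_{k,\ell}^{(m)}$, $1\le m\le 2\min(k,\ell)-1$, are the unique complex numbers with $\omega_{k,\ell}^{(m)}=0$ when $k+\ell-m\ge n$ and such that for all $-k\le i\le k$, $-\ell\le j\le\ell$, $$[G_{k,i},G_{\ell,j}]=\sum_{m=1}^{2\min(k,\ell)-1}\omega_{k,\ell}^{(m)}\,\Phi_{k+\ell-m}^{-1}\big((m_{k,i},m_{\ell,j})_m\big)$$ (terms with $k+\ell-m\ge n$ omitted). By convention $\omega_{a,b}^{(c)}=0$ also if $a$ or $b$ is $\geq n$. *)

theory Defs
  imports
    "HOL-Computational_Algebra.Polynomial"
    "Jordan_Normal_Form.Jordan_Normal_Form"
    "Jordan_Normal_Form.VS_Connect"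
begin

definition mat_trace :: "'a::comm_monoid_add mat \<Rightarrow> 'a" where
  "mat_trace A = (\<Sum>i<dim_row A. A $$ (i, i))"

definition sl :: "nat \<Rightarrow> complex mat set" where
  "sl n = {A \<in> carrier_mat n n. mat_trace A = 0}"

definition lie :: "complex mat \<Rightarrow> complex mat \<Rightarrow> complex mat" where
  "lie A B = A * B - B * A"

definition principal_nilpotent :: "nat \<Rightarrow> complex mat \<Rightarrow> bool" where
  "principal_nilpotent n E \<longleftrightarrow> E \<in> carrier_mat n n \<and> similar_mat E (jordan_block n 0)"

definition principal_sl2_triple :: "nat \<Rightarrow> complex mat \<Rightarrow> complex mat \<Rightarrow> complex mat \<Rightarrow> bool" where
  "principal_sl2_triple n E H F \<longleftrightarrow>
     E \<in> sl n \<and> H \<in> sl n \<and> F \<in> sl n \<and>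
     lie H E = 2 \<cdot>\<^sub>m E \<and> lie H F = (-2) \<cdot>\<^sub>m F \<and> lie E F = H \<and>
     principal_nilpotent n E"

definition Gmat :: "complex mat \<Rightarrow> complex mat \<Rightarrow> nat \<Rightarrow> int \<Rightarrow> complex mat" where
  "Gmat E F i j = ((lie F) ^^ nat (int i - j)) (E ^\<^sub>m i)"

definition Vsp :: "nat \<Rightarrow> complex mat \<Rightarrow> complex mat \<Rightarrow> nat \<Rightarrow> complex mat set" where
  "Vsp n E F i = LinearCombinations.module.span (class_ring :: complex ring) (module_mat TYPE(complex) n n)
     (Gmat E F i ` {- int i..int i})"

(* C[x,y] is represented as C[x][y]: the coefficient of x^a y^b in P is
   coeff (coeff P b) a. *)
type_synonym cxy = "complex poly poly"

definition homogeneous :: "nat \<Rightarrow> cxy \<Rightarrow> bool" where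
  "homogeneous d P \<longleftrightarrow> (\<forall>a b. coeff (coeff P b) a \<noteq> 0 \<longrightarrow> a + b = d)"

definition Hsp :: "nat \<Rightarrow> cxy set" where
  "Hsp d = {P. homogeneous d P}"

definition ddx :: "cxy \<Rightarrow> cxy" where
  "ddx P = map_poly pderiv P"

definition ddy :: "cxy \<Rightarrow> cxy" where
  "ddy P = pderiv P"

definition mpoly_m :: "nat \<Rightarrow> int \<Rightarrow> cxy" where
  "mpoly_m i j = monom (monom (1 / fact (nat (int i + j))) (nat (int i + j))) (nat (int i - j))"

definition transvectant :: "nat \<Rightarrow> cxy \<Rightarrow> cxy \<Rightarrow> cxy" where
  "transvectant m P Q = (\<Sum>s\<le>m. (-1) ^ s * of_nat (m choose s) *
     (ddx ^^ (m - s)) ((ddy ^^ s) P) * (ddx ^^ s) ((ddy ^^ (m - s)) Q))"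

(* phi is unconstrained outside its domain V_i. *)
definition is_Phi :: "nat \<Rightarrow> complex mat \<Rightarrow> complex mat \<Rightarrow> nat \<Rightarrow> (complex mat \<Rightarrow> cxy) \<Rightarrow> bool" where
  "is_Phi n E F i \<phi> \<longleftrightarrow>
     bij_betw \<phi> (Vsp n E F i) (Hsp (2 * i)) \<and>
     (\<forall>A\<in>Vsp n E F i. \<forall>B\<in>Vsp n E F i. \<phi> (A + B) = \<phi> A + \<phi> B) \<and>
     (\<forall>c. \<forall>A\<in>Vsp n E F i. \<phi> (c \<cdot>\<^sub>m A) = Polynomial.smult [:c:] (\<phi> A)) \<and>
     (\<forall>j\<in>{- int i..int i}. \<phi> (Gmat E F i j) = mpoly_m i j)"

(* omega k l m stands for the structure constant with lower indices k, l and upper index m.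
   Arguments outside the stated ranges are unconstrained, apart from the convention that
   omega vanishes when a lower index is at least n. No natural subtraction k + l - m below
   truncates, since m < 2 min(k,l). *)
definition is_structure_constants ::
  "nat \<Rightarrow> complex mat \<Rightarrow> complex mat \<Rightarrow> (nat \<Rightarrow> complex mat \<Rightarrow> cxy) \<Rightarrow>
   (nat \<Rightarrow> nat \<Rightarrow> nat \<Rightarrow> complex) \<Rightarrow> bool" where
  "is_structure_constants n E F \<Phi> \<omega> \<longleftrightarrow>
     (\<forall>k\<in>{1..n-1}. \<forall>l\<in>{1..n-1}. \<forall>m\<in>{1..2 * min k l - 1}. k + l - m \<ge> n \<longrightarrow> \<omega> k l m = 0) \<and>
     (\<forall>k\<in>{1..n-1}. \<forall>l\<in>{1..n-1}. \<forall>i\<in>{- int k..int k}. \<forall>j\<in>{- int l..int l}.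
        lie (Gmat E F k i) (Gmat E F l j) =
        finsum (module_mat TYPE(complex) n n)
          (\<lambda>m. \<omega> k l m \<cdot>\<^sub>m inv_into (Vsp n E F (k + l - m)) (\<Phi> (k + l - m))
                 (transvectant m (mpoly_m k i) (mpoly_m l j)))
          {m \<in> {1..2 * min k l - 1}. k + l - m < n}) \<and>
     (\<forall>a b c. a \<ge> n \<or> b \<ge> n \<longrightarrow> \<omega> a b c = 0)"

end

theory Submission
  imports Defs
begin

text \<open>The trace form is invariant under the bracket with \<open>F\<close>, so vectors \<open>G\<^bsub>a,p\<^esub>\<close> and \<open>G\<^bsub>b,-p\<^esub>\<close> with
  \<open>a \<noteq> b\<close> are orthogonal, while for \<open>a = b\<close> the identity \<open>ad\<^sub>F\<^bsup>2i\<^esup> (E\<^sup>i) = (-1)\<^sup>i (2i)! F\<^sup>i\<close> evaluates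
  the form. Hence both sides of the cyclic identity
  \<open>tr ([G\<^bsub>k,k\<^esub>, G\<^bsub>l,l-m\<^esub>] G\<^bsub>m',-m'\<^esub>) = tr ([G\<^bsub>m',-m'\<^esub>, G\<^bsub>k,k\<^esub>] G\<^bsub>l,l-m\<^esub>)\<close> isolate a single structure
  constant. The indices are chosen so that each transvectant involved, with \<open>x\<^bsup>2k\<^esup>\<close> as an argument,
  reduces to one term.\<close>

section \<open>Traces and iterated brackets\<close>

lemma mat_trace_smult:
  fixes A :: "'a::semiring_0 mat"
  assumes "A \<in> carrier_mat n n"
  shows "mat_trace (c \<cdot>\<^sub>m A) = c * mat_trace A"
  using assms by (simp add: mat_trace_def sum_distrib_left)

lemma mat_trace_add:
  assumes "A \<in> carrier_mat n n" "B \<in> carrier_mat n n"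
  shows "mat_trace (A + B) = mat_trace A + mat_trace B"
  using assms by (simp add: mat_trace_def sum.distrib)

lemma mat_trace_minus:
  fixes A B :: "'a::ab_group_add mat"
  assumes "A \<in> carrier_mat n n" "B \<in> carrier_mat n n"
  shows "mat_trace (A - B) = mat_trace A - mat_trace B"
  using assms by (simp add: mat_trace_def sum_subtractf)

lemma mat_trace_mult_comm:
  fixes A B :: "'a::comm_semiring_0 mat"
  assumes "A \<in> carrier_mat n k" "B \<in> carrier_mat k n"
  shows "mat_trace (A * B) = mat_trace (B * A)"
proof -
  have "mat_trace (A * B) = (\<Sum>i<n. \<Sum>j<k. A $$ (i, j) * B $$ (j, i))"
    using assms by (simp add: mat_trace_def scalar_prod_def atLeast0LessThan)
  also have "\<dots> = (\<Sum>j<k. \<Sum>i<n. B $$ (j, i) * A $$ (i, j))"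
    by (subst sum.swap) (simp add: mult.commute)
  also have "\<dots> = mat_trace (B * A)"
    using assms by (simp add: mat_trace_def scalar_prod_def atLeast0LessThan)
  finally show ?thesis .
qed

lemma lie_dim [simp]: "dim_row (lie A B) = dim_row B" "dim_col (lie A B) = dim_col A"
  by (simp_all add: lie_def)

lemma lie_carrier [simp]:
  "A \<in> carrier_mat n n \<Longrightarrow> B \<in> carrier_mat n n \<Longrightarrow> lie A B \<in> carrier_mat n n"
  unfolding lie_def by (intro minus_carrier_mat mult_carrier_mat)

lemma lie_pow_carrier [simp]:
  "A \<in> carrier_mat n n \<Longrightarrow> B \<in> carrier_mat n n \<Longrightarrow> (lie A ^^ r) B \<in> carrier_mat n n"
  by (induction r) auto

lemma mat_trace_lie_cyclic:
  assumes "A \<in> carrier_mat n n" "B \<in> carrier_mat n n" "C \<in> carrier_mat n n"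
  shows "mat_trace (lie A B * C) = mat_trace (lie C A * B)"
proof -
  have "mat_trace (lie A B * C) = mat_trace (A * B * C) - mat_trace (B * A * C)"
    using assms by (simp add: lie_def minus_mult_distrib_mat[of _ n n _ _ n] mat_trace_minus[of _ n])
  also have "mat_trace (A * B * C) = mat_trace (C * A * B)"
    using assms mat_trace_mult_comm[of "A * B" n n C] by simp
  also have "mat_trace (B * A * C) = mat_trace (A * C * B)"
    using assms mat_trace_mult_comm[of B n n "A * C"] by simp
  also have "mat_trace (C * A * B) - mat_trace (A * C * B) = mat_trace (lie C A * B)"
    using assms by (simp add: lie_def minus_mult_distrib_mat[of _ n n _ _ n] mat_trace_minus[of _ n])
  finally show ?thesis .
qed

lemma mat_trace_lie_skew:
  assumes "A \<in> carrier_mat n n" "B \<in> carrier_mat n n" "C \<in> carrier_mat n n"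
  shows "mat_trace (lie A B * C) = - mat_trace (B * lie A C)"
proof -
  have "mat_trace (lie A B * C) = mat_trace (A * B * C) - mat_trace (B * A * C)"
    using assms by (simp add: lie_def minus_mult_distrib_mat[of _ n n _ _ n] mat_trace_minus[of _ n])
  also have "mat_trace (A * B * C) = mat_trace (B * C * A)"
    using assms mat_trace_mult_comm[of A n n "B * C"] by simp
  also have "mat_trace (B * C * A) - mat_trace (B * A * C) = - mat_trace (B * lie A C)"
    using assms by (simp add: lie_def mult_minus_distrib_mat[of _ n n _ n] mat_trace_minus[of _ n])
  finally show ?thesis .
qed

lemma mat_trace_lie_pow_skew:
  assumes "A \<in> carrier_mat n n" "B \<in> carrier_mat n n" "C \<in> carrier_mat n n"
  shows "mat_trace ((lie A ^^ r) B * C) = (-1) ^ r * mat_trace (B * (lie A ^^ r) C)"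
  using assms(2,3)
proof (induction r arbitrary: C)
  case (Suc r)
  then show ?case
    using assms(1) mat_trace_lie_skew[of A n "(lie A ^^ r) B" C]
    by (simp add: funpow_swap1)
qed simp

lemma lie_zero [simp]: "A \<in> carrier_mat n n \<Longrightarrow> lie A (0\<^sub>m n n) = 0\<^sub>m n n"
  by (simp add: lie_def)

lemma lie_smult:
  assumes "A \<in> carrier_mat n n" "B \<in> carrier_mat n n"
  shows "lie A (c \<cdot>\<^sub>m B) = c \<cdot>\<^sub>m lie A B"
  using assms by (auto simp: lie_def algebra_simps intro!: eq_matI)

lemma lie_add:
  assumes "A \<in> carrier_mat n n" "B \<in> carrier_mat n n" "C \<in> carrier_mat n n"
  shows "lie A (B + C) = lie A B + lie A C"
  using assms unfolding lie_def
  by (simp add: mult_add_distrib_mat[of A n n] add_mult_distrib_mat[of B n n])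
     (auto intro!: eq_matI)

lemma lie_mult:
  assumes "A \<in> carrier_mat n n" "B \<in> carrier_mat n n" "C \<in> carrier_mat n n"
  shows "lie A (B * C) = lie A B * C + B * lie A C"
proof -
  have "lie A B * C + B * lie A C = (A * (B * C) - B * (A * C)) + (B * (A * C) - B * (C * A))"
    using assms by (simp add: lie_def minus_mult_distrib_mat[of _ n n _ _ n] mult_minus_distrib_mat[of _ n n _ n])
  also have "\<dots> = A * (B * C) - B * (C * A)"
    using assms by (auto intro!: eq_matI)
  finally show ?thesis using assms by (simp add: lie_def)
qed

section \<open>Lowering powers of the principal nilpotent element\<close>

context
  fixes n :: nat and E H F :: "complex mat"
  assumes triple: "principal_sl2_triple n E H F"
begin

lemma triple_carrier [simp]:
  "E \<in> carrier_mat n n" "H \<in> carrier_mat n n" "F \<in> carrier_mat n n"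
  using triple by (auto simp: principal_sl2_triple_def sl_def)

lemma triple_dim [simp]:
  "dim_row E = n" "dim_col E = n" "dim_row H = n" "dim_col H = n" "dim_row F = n" "dim_col F = n"
  using triple_carrier by (auto simp only: carrier_matD)

lemma lie_F_E: "lie F E = (-1) \<cdot>\<^sub>m H"
proof -
  have "H = lie E F" using triple by (simp add: principal_sl2_triple_def)
  then show ?thesis
    by (auto simp: lie_def intro!: eq_matI simp del: index_mult_mat(1))
qed

lemma lie_F_H: "lie F H = 2 \<cdot>\<^sub>m F"
proof -
  have "lie F H = (-1) \<cdot>\<^sub>m lie H F"
    using triple_carrier by (auto simp: lie_def intro!: eq_matI simp del: index_mult_mat(1))
  also have "lie H F = (-2) \<cdot>\<^sub>m F" using triple by (simp add: principal_sl2_triple_def)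
  finally show ?thesis by (auto intro!: eq_matI)
qed

lemma lie_F_F: "lie F F = 0\<^sub>m n n"
  by (auto simp: lie_def intro!: eq_matI simp del: index_mult_mat(1))

text \<open>Leibniz rule for the bracket with \<open>F\<close>; it stops after three terms since the third bracket
  of \<open>E\<close> with \<open>F\<close> vanishes.\<close>

lemma lie_F_pow_mult_E:
  assumes Y: "Y \<in> carrier_mat n n"
  shows "(lie F ^^ (r + 2)) (Y * E) =
    (lie F ^^ (r + 2)) Y * E + (- of_nat (r + 2)) \<cdot>\<^sub>m ((lie F ^^ (r + 1)) Y * H) +
    (- of_nat ((r + 2) * (r + 1))) \<cdot>\<^sub>m ((lie F ^^ r) Y * F)"
proof (induction r)
  have E: "lie F (Z * E) = lie F Z * E + (-1) \<cdot>\<^sub>m (Z * H)"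
    and H: "lie F (Z * H) = lie F Z * H + 2 \<cdot>\<^sub>m (Z * F)"
    and F: "lie F (Z * F) = lie F Z * F" if "Z \<in> carrier_mat n n" for Z
    using that by (simp_all add: lie_mult[of _ n] lie_F_E lie_F_H lie_F_F mult_smult_distrib[of _ n n _ n]
        mult_carrier_mat[of _ n n _ n])
  note D = E H F lie_add[of _ n] lie_smult[of _ n] mult_carrier_mat[of _ n n _ n]
  {
    case 0
    show ?case using Y
      by (simp add: D eval_nat_numeral) (auto intro!: eq_matI simp del: index_mult_mat(1))
  next
    case (Suc r)
    define Z where "Z j = (lie F ^^ (r + j)) Y" for j
    have Z [simp]: "Z j \<in> carrier_mat n n" "dim_row (Z j) = n" "dim_col (Z j) = n" for j
      using Y lie_pow_carrier[of F n Y "r + j"] by (auto simp: Z_def simp del: lie_pow_carrier)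
    have lie_Z: "lie F (Z j) = Z (Suc j)" for j by (simp add: Z_def)
    have IH': "(lie F ^^ (r + 2)) (Y * E) = Z 2 * E + (- of_nat (r + 2)) \<cdot>\<^sub>m (Z 1 * H) +
      (- of_nat ((r + 2) * (r + 1))) \<cdot>\<^sub>m (Z 0 * F)"
      using Suc.IH by (simp add: Z_def)
    have "(lie F ^^ (Suc r + 2)) (Y * E) = lie F ((lie F ^^ (r + 2)) (Y * E))" by simp
    also have "\<dots> = Z 3 * E + (-1) \<cdot>\<^sub>m (Z 2 * H) +
      (- of_nat (r + 2)) \<cdot>\<^sub>m (Z 2 * H + 2 \<cdot>\<^sub>m (Z 1 * F)) +
      (- of_nat ((r + 2) * (r + 1))) \<cdot>\<^sub>m (Z 1 * F)"
      unfolding IH' by (simp add: D lie_Z numeral_2_eq_2 numeral_3_eq_3 del: of_nat_add of_nat_mult)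
    \<comment> \<open>Collecting terms uses (r + 2) + 1 = r + 3 and 2 (r + 2) + (r + 2)(r + 1) = (r
      + 3)(r + 2).\<close>
    also have "\<dots> = Z 3 * E + (- of_nat (Suc r + 2)) \<cdot>\<^sub>m (Z 2 * H) +
      (- of_nat ((Suc r + 2) * (Suc r + 1))) \<cdot>\<^sub>m (Z 1 * F)"
      by (auto intro!: eq_matI simp: algebra_simps simp del: index_mult_mat(1))
    finally show ?case by (simp add: Z_def numeral_2_eq_2 numeral_3_eq_3)
  }
qed

lemma lie_F_F_pow: "lie F (F ^\<^sub>m i) = 0\<^sub>m n n"
proof (induction i)
  case 0
  show ?case by (auto simp: lie_def intro!: eq_matI simp del: index_mult_mat(1))
next
  case (Suc i)
  then show ?case by (simp add: lie_mult[of _ n] lie_F_F)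
qed

text \<open>Induction through the Leibniz rule: bracketing E^i more than 2i times gives zero, so of
  the three terms for E^i E only the one with F survives, contributing the factor -(2i + 2)(2i +
  1).\<close>

lemma lie_F_pow_top:
  "(lie F ^^ (2 * i)) (E ^\<^sub>m i) = ((-1) ^ i * fact (2 * i)) \<cdot>\<^sub>m (F ^\<^sub>m i)"
proof (induction i)
  case 0
  then show ?case using triple_carrier by (auto intro!: eq_matI)
next
  case (Suc i)
  have 1: "(lie F ^^ (2 * i + 1)) (E ^\<^sub>m i) = 0\<^sub>m n n"
    using Suc by (simp add: lie_smult[of _ n] lie_F_F_pow)
  have 2: "(lie F ^^ (2 * i + 2)) (E ^\<^sub>m i) = 0\<^sub>m n n"
    using 1 by simp
  have "(lie F ^^ (2 * Suc i)) (E ^\<^sub>m Suc i) = (- of_nat ((2 * i + 2) * (2 * i + 1))) \<cdot>\<^sub>m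
      (((-1) ^ i * fact (2 * i)) \<cdot>\<^sub>m (F ^\<^sub>m i) * F)"
    using lie_F_pow_mult_E[of "E ^\<^sub>m i" "2 * i"] unfolding 1 2 Suc
    by (simp add: mult_carrier_mat[of _ n n _ n])
  also have "\<dots> = ((-1) ^ Suc i * fact (2 * Suc i)) \<cdot>\<^sub>m (F ^\<^sub>m Suc i)"
    by (auto intro!: eq_matI simp: mult_smult_assoc_mat[of _ n n _ n] algebra_simps simp del: index_mult_mat(1))
  finally show ?case .
qed

lemma lie_F_pow_vanish:
  assumes "r > 2 * i"
  shows "(lie F ^^ r) (E ^\<^sub>m i) = 0\<^sub>m n n"
proof -
  have "(lie F ^^ (2 * i + 1 + j)) (E ^\<^sub>m i) = 0\<^sub>m n n" for j
    by (induction j) (simp_all add: lie_F_pow_top lie_smult[of _ n] lie_F_F_pow)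
  then show ?thesis using assms by (metis Suc_eq_plus1 Suc_leI le_add_diff_inverse)
qed

text \<open>The hypothesis says that the two weights are opposite. By skewness all a + b brackets
  can be moved onto either factor. If a and b differ, this is more than twice the smaller exponent,
  so moving them there kills the trace; if a = b, the top bracket yields F^b, and r and s have equal
  parity.\<close>

lemma mat_trace_lie_F_pows:
  assumes "r + s = a + b"
  shows "mat_trace ((lie F ^^ r) (E ^\<^sub>m a) * (lie F ^^ s) (E ^\<^sub>m b)) =
    (if a = b then (-1) ^ (s + b) * fact (2 * b) * mat_trace (E ^\<^sub>m b * F ^\<^sub>m b) else 0)"
proof -
  have left: "mat_trace ((lie F ^^ r) (E ^\<^sub>m a) * (lie F ^^ s) (E ^\<^sub>m b)) =
      (-1) ^ r * mat_trace (E ^\<^sub>m a * (lie F ^^ (a + b)) (E ^\<^sub>m b))"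
    using assms mat_trace_lie_pow_skew[of F n "E ^\<^sub>m a" "(lie F ^^ s) (E ^\<^sub>m b)" r]
    by (simp flip: assms add: funpow_add)
  have "mat_trace ((lie F ^^ (s + r)) (E ^\<^sub>m a) * E ^\<^sub>m b) =
      (-1) ^ s * mat_trace ((lie F ^^ r) (E ^\<^sub>m a) * (lie F ^^ s) (E ^\<^sub>m b))"
    using mat_trace_lie_pow_skew[of F n "(lie F ^^ r) (E ^\<^sub>m a)" "E ^\<^sub>m b" s]
    by (simp add: funpow_add)
  then have right: "mat_trace ((lie F ^^ r) (E ^\<^sub>m a) * (lie F ^^ s) (E ^\<^sub>m b)) =
      (-1) ^ s * mat_trace ((lie F ^^ (a + b)) (E ^\<^sub>m a) * E ^\<^sub>m b)"
    using assms by (simp add: add.commute)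
  have zero: "mat_trace (0\<^sub>m n n :: complex mat) = 0" by (simp add: mat_trace_def)
  consider "a = b" | "a < b" | "b < a" by linarith
  then show ?thesis
  proof cases
    case 1
    have "even (r + s)" using assms 1 by simp
    then have "(-1 :: complex) ^ r = (-1) ^ s" by (metis even_add neg_one_even_power neg_one_odd_power)
    then show ?thesis using 1 left lie_F_pow_top[of b]
      by (simp add: mult_smult_distrib[of _ n n _ n] mat_trace_smult[of _ n]
        mult_carrier_mat[of _ n n _ n] power_add flip: mult_2)
  next
    case 2
    then show ?thesis using right by (simp add: lie_F_pow_vanish zero)
  next
    case 3
    then show ?thesis using left by (simp add: lie_F_pow_vanish zero)
  qed
qed

section \<open>Reading off structure constants\<close>

lemma is_Phi_inv:
  assumes \<phi>: "is_Phi n E F i \<phi>" and j: "j \<in> {- int i..int i}"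
  shows "inv_into (Vsp n E F i) \<phi> (Polynomial.smult [:c:] (mpoly_m i j)) = c \<cdot>\<^sub>m Gmat E F i j"
proof -
  interpret V: vectorspace "class_ring :: complex ring" "module_mat TYPE(complex) n n"
    by (rule matrix_vs)
  let ?S = "Gmat E F i ` {- int i..int i}"
  have S: "?S \<subseteq> carrier (module_mat TYPE(complex) n n)"
    by (auto simp: matrix_vs_simps Gmat_def)
  have G: "Gmat E F i j \<in> Vsp n E F i"
    unfolding Vsp_def using V.in_own_span[OF S] j by auto
  \<comment> \<open>Inverting by \<open>inv_into\<close> requires the scaled vector itself to lie in
    the span.\<close>
  have "submodule class_ring (V.span ?S) (module_mat TYPE(complex) n n)"
    using V.span_is_submodule[OF S] .
  then have cG: "c \<cdot>\<^sub>m Gmat E F i j \<in> Vsp n E F i"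
    using G submodule.smult_closed[of class_ring "V.span ?S" "module_mat TYPE(complex) n n"]
    by (simp add: Vsp_def matrix_vs_simps)
  have "\<phi> (c \<cdot>\<^sub>m Gmat E F i j) = Polynomial.smult [:c:] (mpoly_m i j)"
    using \<phi> G j by (auto simp: is_Phi_def)
  moreover have "inj_on \<phi> (Vsp n E F i)"
    using \<phi> by (auto simp: is_Phi_def bij_betw_def)
  ultimately show ?thesis using cG by (metis inv_into_f_f)
qed

lemma mat_trace_finsum_mult:
  assumes "finite S" "\<And>x. x \<in> S \<Longrightarrow> f x \<in> carrier_mat n n" "B \<in> carrier_mat n n"
  shows "mat_trace (finsum (module_mat TYPE(complex) n n) f S * B) = (\<Sum>x\<in>S. mat_trace (f x * B))"
  using assms(1,2)
proof (induction S rule: finite_induct)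
  interpret abelian_group "module_mat TYPE(complex) n n" by (rule abelian_group_mat)
  {
    case empty
    show ?case using assms(3) by (simp add: module_mat_simps mat_trace_def)
  next
    case (insert x S)
    have fin: "finsum (module_mat TYPE(complex) n n) f S \<in> carrier_mat n n"
      using finsum_closed[of f S] insert.prems by (auto simp: module_mat_simps)
    have "finsum (module_mat TYPE(complex) n n) f (insert x S) =
        f x + finsum (module_mat TYPE(complex) n n) f S"
      using insert finsum_insert[of S x f] by (auto simp: module_mat_simps)
    then show ?case
      using insert fin assms(3)
      by (simp add: add_mult_distrib_mat[of _ n n _ _ n] mat_trace_add[of _ n] mult_carrier_mat[of _ n n _ n])
  }
qed

text \<open>The bracket has weight \<open>2 * (i + j)\<close> and is paired with a vector of the opposite weight in \<open>V\<^sub>b\<close>, so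
  only its component in \<open>V\<^sub>b\<close> survives. When \<open>V\<close> with index \<open>k + l - \<mu>\<close> has no vector of that weight,
  \<open>mpoly_m\<close> and \<open>Gmat\<close> take junk values at \<open>i + j\<close>; this is the case \<open>c \<mu> = 0\<close>.\<close>

lemma mat_trace_bracket:
  assumes \<Phi>: "\<And>i. 1 \<le> i \<Longrightarrow> i \<le> n - 1 \<Longrightarrow> is_Phi n E F i (\<Phi> i)"
    and \<omega>: "is_structure_constants n E F \<Phi> \<omega>"
    and k: "k \<in> {1..n-1}" and l: "l \<in> {1..n-1}"
    and i: "i \<in> {- int k..int k}" and j: "j \<in> {- int l..int l}"
    and m: "m \<in> {1..2 * min k l - 1}" and b: "b = k + l - m" "b < n"
    and s: "int s = int b + i + j"
    and tv: "\<And>\<mu>. \<mu> \<in> {1..2 * min k l - 1} \<Longrightarrow>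
      transvectant \<mu> (mpoly_m k i) (mpoly_m l j) =
        Polynomial.smult [:c \<mu>:] (mpoly_m (k + l - \<mu>) (i + j)) \<and>
      (c \<mu> = 0 \<or> \<bar>i + j\<bar> \<le> int (k + l - \<mu>))"
  shows "mat_trace (lie (Gmat E F k i) (Gmat E F l j) * (lie F ^^ s) (E ^\<^sub>m b)) =
    \<omega> k l m * c m * ((-1) ^ (s + b) * fact (2 * b) * mat_trace (E ^\<^sub>m b * F ^\<^sub>m b))"
proof -
  let ?S = "{m \<in> {1..2 * min k l - 1}. k + l - m < n}"
  let ?B = "(lie F ^^ s) (E ^\<^sub>m b)"
  let ?W = "\<lambda>\<mu>. inv_into (Vsp n E F (k + l - \<mu>)) (\<Phi> (k + l - \<mu>))
      (transvectant \<mu> (mpoly_m k i) (mpoly_m l j))"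
  have W: "?W \<mu> \<in> carrier_mat n n \<and>
      mat_trace (?W \<mu> * ?B) = (if \<mu> = m then c m * ((-1) ^ (s + b) * fact (2 * b) *
        mat_trace (E ^\<^sub>m b * F ^\<^sub>m b)) else 0)" if "\<mu> \<in> ?S" for \<mu>
  proof -
    let ?a = "k + l - \<mu>"
    have a: "1 \<le> ?a" "?a \<le> n - 1" "\<mu> < k + l" using that by auto
    \<comment> \<open>Both m and \<mu> are below k + l, so no subtraction truncates and each \<mu>
      has its own target space.\<close>
    have am: "?a = b \<longleftrightarrow> \<mu> = m" using that m b by auto
    note inv = is_Phi_inv[OF \<Phi>[OF a(1,2)]]
    note tv' = tv[of \<mu>]
    show ?thesis
    proof (cases "c \<mu> = 0")
      case True
      \<comment> \<open>The zero polynomial is presented as 0 times the weight-zero monomial, since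
        index 0 is admissible in every V.\<close>
      then have "?W \<mu> = 0 \<cdot>\<^sub>m Gmat E F ?a 0"
        using tv' that inv[of 0 0] by simp
      then show ?thesis
        using True by (simp add: Gmat_def mult_smult_assoc_mat[of _ n n _ n] mat_trace_smult[of _ n]
          mult_carrier_mat[of _ n n _ n]) auto
    next
      case False
      then have ij: "i + j \<in> {- int ?a..int ?a}" using tv' that by auto
      have W: "?W \<mu> = c \<mu> \<cdot>\<^sub>m Gmat E F ?a (i + j)"
        using tv' that inv[OF ij] by simp
      \<comment> \<open>The choice of s makes the two weights opposite, as
        \<open>mat_trace_lie_F_pows\<close> demands.\<close>
      have "nat (int ?a - (i + j)) + s = ?a + b"
        using s ij by auto
      from mat_trace_lie_F_pows[OF this] show ?thesis
        unfolding W by (auto simp: Gmat_def mult_smult_assoc_mat[of _ n n _ n] mat_trace_smult[of _ n]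
          mult_carrier_mat[of _ n n _ n] am)
    qed
  qed
  have "mat_trace (lie (Gmat E F k i) (Gmat E F l j) * ?B) =
      mat_trace (finsum (module_mat TYPE(complex) n n) (\<lambda>m. \<omega> k l m \<cdot>\<^sub>m ?W m) ?S * ?B)"
    using \<omega> k l i j by (simp add: is_structure_constants_def)
  also have "\<dots> = (\<Sum>\<mu>\<in>?S. mat_trace ((\<omega> k l \<mu> \<cdot>\<^sub>m ?W \<mu>) * ?B))"
    by (rule mat_trace_finsum_mult) (use W in auto)
  also have "\<dots> = (\<Sum>\<mu>\<in>?S. if \<mu> = m then \<omega> k l m * c m * ((-1) ^ (s + b) * fact (2 * b) *
        mat_trace (E ^\<^sub>m b * F ^\<^sub>m b)) else 0)"
  proof (intro sum.cong refl)
    fix \<mu> assume \<mu>: "\<mu> \<in> ?S"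
    have "mat_trace ((\<omega> k l \<mu> \<cdot>\<^sub>m ?W \<mu>) * ?B) = \<omega> k l \<mu> * mat_trace (?W \<mu> * ?B)"
      using W[OF \<mu>] by (simp add: mult_smult_assoc_mat[of _ n n _ n] mat_trace_smult[of _ n]
          mult_carrier_mat[of _ n n _ n])
    then show "mat_trace ((\<omega> k l \<mu> \<cdot>\<^sub>m ?W \<mu>) * ?B) = (if \<mu> = m then \<omega> k l m * c m *
        ((-1) ^ (s + b) * fact (2 * b) * mat_trace (E ^\<^sub>m b * F ^\<^sub>m b)) else 0)"
      using W[OF \<mu>] by simp
  qed
  also have "\<dots> = \<omega> k l m * c m * ((-1) ^ (s + b) * fact (2 * b) * mat_trace (E ^\<^sub>m b * F ^\<^sub>m b))"
    using m b by (subst sum.delta) auto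
  finally show ?thesis .
qed

end

section \<open>Transvectants of extreme monomials\<close>

text \<open>A divided power in x times an ordinary power of y, as in \<open>mpoly_m\<close>:
  x-derivatives only shift the exponent, and numerical factors come from y-derivatives and
  products.\<close>

definition dmonom :: "complex \<Rightarrow> nat \<Rightarrow> nat \<Rightarrow> cxy" where
  "dmonom c p q = monom (monom (c / fact p) p) q"

lemma mpoly_m_dmonom: "mpoly_m i j = dmonom 1 (nat (int i + j)) (nat (int i - j))"
  by (simp add: mpoly_m_def dmonom_def)

lemma smult_dmonom: "Polynomial.smult [:c:] (dmonom d p q) = dmonom (c * d) p q"
  by (simp add: dmonom_def smult_monom)

lemma dmonom_0 [simp]: "dmonom 0 p q = 0"
  by (simp add: dmonom_def)

lemma ddx_0 [simp]: "ddx 0 = 0" and ddy_0 [simp]: "ddy 0 = 0"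
  by (simp_all add: ddx_def ddy_def)

lemma ddx_pow_0 [simp]: "(ddx ^^ r) 0 = 0" and ddy_pow_0 [simp]: "(ddy ^^ r) 0 = 0"
  by (induction r) simp_all

text \<open>The case p = 0 is separate because truncated subtraction would leave the monomial
  unchanged; for \<open>ddy\<close> the factor q takes care of this.\<close>

lemma ddx_dmonom: "ddx (dmonom c p q) = (if p = 0 then 0 else dmonom c (p - 1) q)"
  by (cases p) (simp_all add: ddx_def dmonom_def map_poly_monom pderiv_monom
      del: of_nat_Suc)

lemma ddy_dmonom: "ddy (dmonom c p q) = dmonom (of_nat q * c) p (q - 1)"
  by (simp add: ddy_def dmonom_def pderiv_monom of_nat_poly smult_monom)

lemma ddx_pow_dmonom: "(ddx ^^ r) (dmonom c p q) = (if r \<le> p then dmonom c (p - r) q else 0)"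
  by (induction r) (auto simp: ddx_dmonom)

lemma ddy_pow_dmonom:
  "(ddy ^^ r) (dmonom c p q) = (if r \<le> q then dmonom (fact q / fact (q - r) * c) p (q - r) else 0)"
proof (induction r)
  case (Suc r)
  have "fact (q - r) = of_nat (q - r) * (fact (q - Suc r) :: complex)" if "r < q"
    using that by (metis Suc_diff_Suc fact_Suc of_nat_fact of_nat_mult)
  then show ?case using Suc by (auto simp: ddy_dmonom not_le)
qed simp

lemma dmonom_mult:
  "dmonom c p q * dmonom d r s = dmonom (c * d * fact (p + r) / (fact p * fact r)) (p + r) (q + s)"
  by (simp add: dmonom_def mult_monom)

text \<open>The first argument contains no y, so only s = 0 survives. The binomial factor comes from
  multiplying divided powers, the falling factorial from differentiating in y.\<close>

lemma transvectant_highest: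
  assumes "\<mu> \<le> p"
  shows "transvectant \<mu> (dmonom 1 p 0) (dmonom 1 q r) =
    (if \<mu> \<le> r then dmonom (fact (p - \<mu> + q) / (fact (p - \<mu>) * fact q) * (fact r / fact (r - \<mu>)))
      (p - \<mu> + q) (r - \<mu>) else 0)"
proof -
  have "transvectant \<mu> (dmonom 1 p 0) (dmonom 1 q r) =
      (\<Sum>s\<le>\<mu>. if s = 0 then (ddx ^^ \<mu>) (dmonom 1 p 0) * (ddy ^^ \<mu>) (dmonom 1 q r) else 0)"
    unfolding transvectant_def by (intro sum.cong) (auto simp: ddy_pow_dmonom)
  then show ?thesis using assms
    by (simp add: ddx_pow_dmonom ddy_pow_dmonom dmonom_mult mult.commute)
qed

text \<open>A pure power of y admits no x-derivative, so only s = \<mu> survives.\<close>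

lemma transvectant_opposite:
  assumes "\<mu> \<le> p" "\<mu> \<le> q"
  shows "transvectant \<mu> (dmonom 1 0 p) (dmonom 1 q 0) =
    dmonom ((-1) ^ \<mu> * (fact p / fact (p - \<mu>))) (q - \<mu>) (p - \<mu>)"
proof -
  have "transvectant \<mu> (dmonom 1 0 p) (dmonom 1 q 0) =
      (\<Sum>s\<le>\<mu>. if s = \<mu> then (-1) ^ \<mu> * (ddy ^^ \<mu>) (dmonom 1 0 p) * (ddx ^^ \<mu>) (dmonom 1 q 0) else 0)"
    unfolding transvectant_def by (intro sum.cong) (auto simp: ddx_pow_dmonom ddy_pow_dmonom)
  also have "\<dots> = (-1) ^ \<mu> * dmonom (fact p / fact (p - \<mu>)) (q - \<mu>) (p - \<mu>)"
    using assms by (simp add: ddx_pow_dmonom ddy_pow_dmonom dmonom_mult mult.assoc)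
  also have "\<dots> = dmonom ((-1) ^ \<mu> * (fact p / fact (p - \<mu>))) (q - \<mu>) (p - \<mu>)"
    \<comment> \<open>The sign is a constant polynomial; splitting by parity moves it into the
      coefficient.\<close>
    by (cases "even \<mu>") (simp_all add: dmonom_def minus_monom)
  finally show ?thesis .
qed

section \<open>Comparing two evaluations of the cyclic trace\<close>

theorem proposition4p4:
  fixes n k l m m' :: nat
    and E H F :: "complex mat"
    and \<Phi> :: "nat \<Rightarrow> complex mat \<Rightarrow> complex poly poly"
    and \<omega> :: "nat \<Rightarrow> nat \<Rightarrow> nat \<Rightarrow> complex"
  assumes "n \<ge> 2"
    and "principal_sl2_triple n E H F"
    and "\<And>i. 1 \<le> i \<Longrightarrow> i \<le> n - 1 \<Longrightarrow> is_Phi n E F i (\<Phi> i)"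
    and "is_structure_constants n E F \<Phi> \<omega>"
    and "1 \<le> l" and "l \<le> k" and "k \<le> n - 1"
    and "1 \<le> m" and "m \<le> 2 * l - 1" and "odd m"
    and "m' = k + l - m"
  shows "(-1) ^ (k + 1) * fact (2 * m') * mat_trace (E ^\<^sub>m m' * F ^\<^sub>m m') * \<omega> k l m
       = mat_trace (E ^\<^sub>m l * F ^\<^sub>m l) * (fact (2 * k - m) * fact (2 * l) / fact m) *
         \<omega> m' k (2 * k - m)"
proof (cases "m' < n")
  case False
  \<comment> \<open>Here the left constant vanishes because its target index is at least n, the
    right one by the convention on lower indices.\<close>
  have "\<omega> k l m = 0"
    using assms False unfolding is_structure_constants_def by (auto simp: min_def)
  moreover have "\<omega> m' k (2 * k - m) = 0"
    using assms(4) False unfolding is_structure_constants_def by auto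
  ultimately show ?thesis by simp
next
  case True
  note [simp] = triple_carrier[OF assms(2)]
  define T where "T i = mat_trace (E ^\<^sub>m i * F ^\<^sub>m i)" for i
  \<comment> \<open>The cut at m reflects the y-degree m of the second monomial; beyond it the
    weight m' no longer fits into the target space.\<close>
  define c1 :: "nat \<Rightarrow> complex" where "c1 \<mu> = (if \<mu> \<le> m then
    fact (2 * k - \<mu> + (2 * l - m)) / (fact (2 * k - \<mu>) * fact (2 * l - m)) * (fact m / fact (m - \<mu>))
    else 0)" for \<mu>
  define c2 :: "nat \<Rightarrow> complex" where "c2 \<mu> = (-1) ^ \<mu> * (fact (2 * m') / fact (2 * m' - \<mu>))" for \<mu>
  define A where "A = Gmat E F k (int k)"
  define B where "B = Gmat E F l (int l - int m)"
  define C where "C = Gmat E F m' (- int m')"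
  have B: "B = (lie F ^^ m) (E ^\<^sub>m l)" by (simp add: B_def Gmat_def)
  have C: "C = (lie F ^^ (2 * m')) (E ^\<^sub>m m')"
    by (simp add: C_def Gmat_def nat_add_distrib nat_mult_distrib flip: mult_2)
  have m': "1 \<le> m'" "int m' = int k + int l - int m" using assms by auto
  \<comment> \<open>Weights add up as k + (l - m) = m', so the pairing is with V of index b = m' and
    s = 2m'.\<close>
  have "mat_trace (lie A B * C) =
      \<omega> k l m * c1 m * ((-1) ^ (2 * m' + m') * fact (2 * m') * T m')"
    unfolding A_def B_def C T_def
  proof (rule mat_trace_bracket[OF assms(2-4)])
    fix \<mu> assume \<mu>: "\<mu> \<in> {1..2 * min k l - 1}"
    have "mpoly_m k (int k) = dmonom 1 (2 * k) 0" "mpoly_m l (int l - int m) = dmonom 1 (2 * l - m) m"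
      using assms by (auto simp: mpoly_m_dmonom nat_diff_distrib nat_add_distrib intro!: arg_cong2[of _ _ _ _ "dmonom 1"])
    moreover have "mpoly_m (k + l - \<mu>) (int k + (int l - int m)) =
        dmonom 1 (2 * k - \<mu> + (2 * l - m)) (m - \<mu>)" if "\<mu> \<le> m"
      unfolding mpoly_m_dmonom using that assms \<mu> by (intro arg_cong2[of _ _ _ _ "dmonom 1"]) auto
    ultimately show "transvectant \<mu> (mpoly_m k (int k)) (mpoly_m l (int l - int m)) =
        Polynomial.smult [:c1 \<mu>:] (mpoly_m (k + l - \<mu>) (int k + (int l - int m))) \<and>
      (c1 \<mu> = 0 \<or> \<bar>int k + (int l - int m)\<bar> \<le> int (k + l - \<mu>))"
      using \<mu> assms by (auto simp: transvectant_highest smult_dmonom c1_def)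
  qed (use assms True m' in auto)
  \<comment> \<open>Now b = l, since m' + k - (2k - m) = l, and s = l - m' + k = m. The weight k -
    m' fits every target space, so \<open>c2\<close> needs no case split.\<close>
  moreover have "mat_trace (lie C A * B) =
      \<omega> m' k (2 * k - m) * c2 (2 * k - m) * ((-1) ^ (m + l) * fact (2 * l) * T l)"
    unfolding A_def B C_def T_def
  proof (rule mat_trace_bracket[OF assms(2-4)])
    fix \<mu> assume \<mu>: "\<mu> \<in> {1..2 * min m' k - 1}"
    have "mpoly_m k (int k) = dmonom 1 (2 * k) 0" "mpoly_m m' (- int m') = dmonom 1 0 (2 * m')"
      by (auto simp: mpoly_m_dmonom nat_add_distrib intro!: arg_cong2[of _ _ _ _ "dmonom 1"])
    moreover have "mpoly_m (m' + k - \<mu>) (- int m' + int k) = dmonom 1 (2 * k - \<mu>) (2 * m' - \<mu>)"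
      unfolding mpoly_m_dmonom using \<mu> by (intro arg_cong2[of _ _ _ _ "dmonom 1"]) auto
    ultimately show "transvectant \<mu> (mpoly_m m' (- int m')) (mpoly_m k (int k)) =
        Polynomial.smult [:c2 \<mu>:] (mpoly_m (m' + k - \<mu>) (- int m' + int k)) \<and>
      (c2 \<mu> = 0 \<or> \<bar>- int m' + int k\<bar> \<le> int (m' + k - \<mu>))"
      using \<mu> by (auto simp: transvectant_opposite smult_dmonom c2_def)
  qed (use assms True m' in auto)
  moreover have "mat_trace (lie A B * C) = mat_trace (lie C A * B)"
    by (rule mat_trace_lie_cyclic[of _ n]) (auto simp: A_def B C Gmat_def)
  ultimately have eq: "\<omega> k l m * c1 m * ((-1) ^ (2 * m' + m') * fact (2 * m') * T m') =
      \<omega> m' k (2 * k - m) * c2 (2 * k - m) * ((-1) ^ (m + l) * fact (2 * l) * T l)"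
    by simp
  have c1: "c1 m = fact (2 * m') * fact m / (fact (2 * k - m) * fact (2 * l - m))"
  proof -
    have "2 * k - m + (2 * l - m) = 2 * m'" using assms by auto
    then show ?thesis by (simp add: c1_def)
  qed
  \<comment> \<open>Oddness of m makes 2k - m odd; the resulting minus sign turns (-1)^k into
    (-1)^(k+1) in the result.\<close>
  have c2: "c2 (2 * k - m) = - (fact (2 * m') / fact (2 * l - m))"
  proof -
    have "2 * m' - (2 * k - m) = 2 * l - m" "odd (2 * k - m)" using assms by auto
    then show ?thesis by (simp add: c2_def)
  qed
  have sign: "(-1 :: complex) ^ (2 * m' + m') = (-1) ^ k * (-1) ^ (m + l)"
  proof -
    have "even (2 * m' + m') = even (k + (m + l))" using assms by auto
    then show ?thesis by (metis neg_one_even_power neg_one_odd_power power_add)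
  qed
  have "(-1) ^ k * fact m * fact (2 * m') * T m' * \<omega> k l m =
      - (fact (2 * k - m) * fact (2 * l) * T l * \<omega> m' k (2 * k - m))"
  proof -
    \<comment> \<open>The nonzero factor common to both sides of \<open>eq\<close> is exhibited in
      order to be cancelled.\<close>
    have "fact (2 * m') / fact (2 * l - m) * (-1) ^ (m + l) / fact (2 * k - m) *
        ((-1) ^ k * fact m * fact (2 * m') * T m' * \<omega> k l m) =
      fact (2 * m') / fact (2 * l - m) * (-1) ^ (m + l) / fact (2 * k - m) *
        (- (fact (2 * k - m) * fact (2 * l) * T l * \<omega> m' k (2 * k - m)))"
      using eq unfolding c1 c2 sign by (simp add: field_simps)
    then show ?thesis by (subst (asm) mult_left_cancel) auto
  qed
  then show ?thesis by (simp add: T_def field_simps)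
qed

end
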